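(* Let $n$ be a positive integer, $y_n=\frac{n+\sqrt{n^2+4}}{2}=[n,n,n,\dots]$, and $\langle n\rangle_q=q[n]_q+(1+q^n)(1-q)$. Then (i) $$[y_n]_q=[n]_q+\cfrac{q^{2n}}{\langle n\rangle_q+\cfrac{q^{2n+1}}{\langle n\rangle_q+\cfrac{q^{2n+1}}{\ddots}}}\qquad\text{and}\qquad \sigma_q(y_n)=\cfrac{q^{n-1}}{\langle n\rangle_q+\cfrac{q^{2n+1}}{\langle n\rangle_q+\cfrac{q^{2n+1}}{\ddots}}},$$ where $\sigma_q(y_n)=\frac{[y_n]_q-[n]_q}{q^{n+1}}$; (ii) the second continued fraction in (i) is a super $\delta$-fraction with $\delta=3$.
   Context: For $a\in\mathbb{Z}$ put $[a]_q=\frac{1-q^a}{1-q}$ and $[a]_{q^{-1}}=q^{1-a}[a]_q$. For irrational $x=[a_1,a_2,\dots]$ (regular continued fraction, $a_1\in\mathbb{Z}$, $a_i\ge1$ for $i\ge2$), its $q$-deformation is $[x]_q=[a_1]_q+\cfrac{q^{a_1}}{[a_2]_{q^{-1}}+\cfrac{q^{-a_2}}{[a_3]_q+\cfrac{q^{a_3}}{[a_4]_{q^{-1}}+\ddots}}}$, the limit of the finite truncations (whose coefficients stabilize); for $x=y_n$ this is a formal power series and $\sigma_q(y_n)$ is again a formal power series. Infinite continued fractions denote $q$-adic limits of their truncations. For a positive integer $\delta$, a super $\delta$-fraction is a continued fraction of the form $$\cfrac{v_0q^{k_0}}{1+qU_1(q)-\cfrac{v_1q^{k_0+k_1+\delta}}{1+qU_2(q)-\cfrac{v_2q^{k_1+k_2+\delta}}{1+qU_3(q)-\ddots}}}$$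 with nonzero constants $v_i$, integers $k_i\ge0$, and polynomials $U_i$ with $\deg U_i\le k_{i-1}+\delta-2$. *)

theory Defs
  imports Complex_Main
    "HOL-Computational_Algebra.Formal_Laurent_Series"
    "HOL-Computational_Algebra.Polynomial_FPS"
begin

text \<open>
  Rational functions in \<open>q\<close> are expanded at \<open>q = 0\<close>, i.e. everything lives in the field of formal
  Laurent series over a field of constants, with \<open>q\<close> being \<^const>\<open>fls_X\<close>. The library metric on
  \<open>'a fls\<close> is the \<open>q\<close>-adic one, so \<open>lim\<close> and \<open>\<longlonglongrightarrow>\<close> are \<open>q\<close>-adic limits.
\<close>

text \<open>
  \<open>cfrac_trunc c b N\<close> is \<open>b 0 + c 0 / (b 1 + c 1 / (b 2 + \<dots> + c (N - 1) / b N))\<close>; an infinite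
  continued fraction is given by its sequences \<open>c\<close>, \<open>b\<close> of partial numerators and denominators.
\<close>
fun cfrac_trunc :: "(nat \<Rightarrow> 'k) \<Rightarrow> (nat \<Rightarrow> 'k) \<Rightarrow> nat \<Rightarrow> 'k::field" where
  "cfrac_trunc c b 0 = b 0"
| "cfrac_trunc c b (Suc N) = b 0 + c 0 / cfrac_trunc (\<lambda>i. c (Suc i)) (\<lambda>i. b (Suc i)) N"

text \<open>
  Regular continued fraction of an irrational \<open>x\<close>, with indices starting at 0: \<open>cf_quot x i\<close> is
  the partial quotient \<open>a\<^bsub>i+1\<^esub>\<close>. (The expansion of a rational does not terminate properly here:
  division by zero produces spurious zeros.)
\<close>
primrec cf_complete_quot :: "real \<Rightarrow> nat \<Rightarrow> real" where
  "cf_complete_quot x 0 = x"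
| "cf_complete_quot x (Suc i) = 1 / frac (cf_complete_quot x i)"

definition cf_quot :: "real \<Rightarrow> nat \<Rightarrow> int" where
  "cf_quot x i = \<lfloor>cf_complete_quot x i\<rfloor>"

definition q_int :: "int \<Rightarrow> 'a::field fls" where
  "q_int a = (1 - fls_X powi a) / (1 - fls_X)"

definition q_int_inv :: "int \<Rightarrow> 'a::field fls" where
  "q_int_inv a = fls_X powi (1 - a) * q_int a"

definition q_real_num :: "real \<Rightarrow> nat \<Rightarrow> 'a::field fls" where
  "q_real_num x i = (if even i then fls_X powi (cf_quot x i) else fls_X powi (- cf_quot x i))"

definition q_real_den :: "real \<Rightarrow> nat \<Rightarrow> 'a::field fls" where
  "q_real_den x i = (if even i then q_int (cf_quot x i) else q_int_inv (cf_quot x i))"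

definition q_real :: "real \<Rightarrow> 'a::field fls" where
  "q_real x = lim (cfrac_trunc (q_real_num x) (q_real_den x))"

definition metallic :: "nat \<Rightarrow> real" where
  "metallic n = (real n + sqrt ((real n)\<^sup>2 + 4)) / 2"

definition sigma_q_metallic :: "nat \<Rightarrow> 'a::field fls" where
  "sigma_q_metallic n = (q_real (metallic n) - q_int (int n)) / fls_X ^ (n + 1)"

definition q_angle :: "nat \<Rightarrow> 'a::field fls" where
  "q_angle n = fls_X * q_int (int n) + (1 + fls_X ^ n) * (1 - fls_X)"

definition metallic_num :: "nat \<Rightarrow> nat \<Rightarrow> 'a::field fls" where
  "metallic_num n i = (if i = 0 then fls_X ^ (2 * n) else fls_X ^ (2 * n + 1))"

definition metallic_den :: "nat \<Rightarrow> nat \<Rightarrow> 'a::field fls" where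
  "metallic_den n i = (if i = 0 then q_int (int n) else q_angle n)"

definition sigma_num :: "nat \<Rightarrow> nat \<Rightarrow> 'a::field fls" where
  "sigma_num n i = (if i = 0 then fls_X ^ (n - 1) else fls_X ^ (2 * n + 1))"

definition sigma_den :: "nat \<Rightarrow> nat \<Rightarrow> 'a::field fls" where
  "sigma_den n i = (if i = 0 then 0 else q_angle n)"

text \<open>
  The minus signs of the super fraction are absorbed into the partial numerators \<open>c i\<close>, \<open>i \<ge> 1\<close>.
  The zero polynomial has degree \<open>-\<infinity>\<close> in the degree bound (it is the only \<open>U i\<close> allowed when
  \<open>\<delta> = 1\<close> and \<open>k (i - 1) = 0\<close>).
\<close>
definition super_fraction :: "nat \<Rightarrow> (nat \<Rightarrow> 'a::field fls) \<Rightarrow> (nat \<Rightarrow> 'a fls) \<Rightarrow> bool" where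
  "super_fraction \<delta> c b \<longleftrightarrow> \<delta> > 0 \<and>
     (\<exists>(v :: nat \<Rightarrow> 'a) (k :: nat \<Rightarrow> nat) (U :: nat \<Rightarrow> 'a poly).
        (\<forall>i. v i \<noteq> 0) \<and>
        (\<forall>i\<ge>1. U i = 0 \<or> int (degree (U i)) \<le> int (k (i - 1)) + int \<delta> - 2) \<and>
        c 0 = fls_const (v 0) * fls_X ^ k 0 \<and>
        (\<forall>i\<ge>1. c i = - (fls_const (v i) * fls_X ^ (k (i - 1) + k i + \<delta>))) \<and>
        b 0 = 0 \<and>
        (\<forall>i\<ge>1. b i = 1 + fls_X * fps_to_fls (fps_of_poly (U i))))"

end

theory Submission
  imports Defs
begin

text \<open>
  Put \<open>A = [n]\<^sub>q\<close> and \<open>B = \<langle>n\<rangle>\<^sub>q\<close>. Two consecutive steps of the continued fraction of \<open>[y\<^sub>n]\<^sub>q\<close>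
  combine to \<open>M x = A + q\<^bsup>2n\<^esup> x / (1 + q A x)\<close>, in which no negative power of \<open>q\<close> is left: \<open>M\<close> is a
  \<open>q\<close>-adic contraction of the power series, so both the even and the odd truncations converge to
  its fixed point. Likewise \<open>z \<mapsto> B + q\<^bsup>2n+1\<^esup> / z\<close> is a contraction of the power series with
  constant term 1; let \<open>z\<close> be its fixed point. Because \<open>A B = 1 + q A\<^sup>2 - q\<^bsup>2n\<^esup>\<close>, the series
  \<open>A + q\<^bsup>2n\<^esup> / z\<close> is fixed by \<open>M\<close>, hence equals \<open>[y\<^sub>n]\<^sub>q\<close>.
\<close>

section \<open>Convergence of power series\<close>

lemma fps_X_power_dvd_iff:
  fixes f :: "'a::field fps"
  shows "fps_X ^ k dvd f \<longleftrightarrow> (\<forall>i<k. f $ i = 0)"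
proof (cases "f = 0")
  case False
  then have "fps_X ^ k dvd f \<longleftrightarrow> k \<le> subdegree f"
    by (simp add: fps_dvd_iff fps_X_power_subdegree)
  also have "\<dots> \<longleftrightarrow> (\<forall>i<k. f $ i = 0)"
    using False
    by (meson nth_less_subdegree_zero nth_subdegree_nonzero not_less order_less_le_trans)
  finally show ?thesis .
qed simp

lemma fps_eq_0_if_X_power_dvd:
  fixes f :: "'a::field fps"
  assumes "\<And>k. fps_X ^ k dvd f"
  shows "f = 0"
  using assms by (auto simp: fps_X_power_dvd_iff fps_eq_iff)

text \<open>Completeness: passing from \<open>f k\<close> to \<open>f (Suc k)\<close> affects only
  coefficients of index at least \<open>k\<close>, so the coefficient of index \<open>i\<close> is
  frozen from \<open>f (Suc i)\<close> on.\<close>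

lemma fps_X_adic_limit_exists:
  fixes f :: "nat \<Rightarrow> 'a::field fps"
  assumes "\<And>k. fps_X ^ k dvd f (Suc k) - f k"
  shows "\<exists>g. \<forall>k. fps_X ^ k dvd f k - g"
proof -
  define g where "g = Abs_fps (\<lambda>k. f (Suc k) $ k)"
  have stable: "f k $ i = f (Suc i) $ i" if "Suc i \<le> k" for i k
    using that
  proof (induction k rule: dec_induct)
    case (step m)
    then show ?case using assms[of m] by (simp add: fps_X_power_dvd_iff)
  qed simp
  have "fps_X ^ k dvd f k - g" for k
    unfolding fps_X_power_dvd_iff
  proof (intro allI impI)
    fix i assume "i < k"
    then show "(f k - g) $ i = 0"
      using stable[of i k] by (simp add: g_def)
  qed
  then show ?thesis by blast
qed

text \<open>Links divisibility to the metric. The rate \<open>h\<close> is left general because the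
  truncations of \<open>q_real\<close> are controlled only to order \<open>N div 2\<close>.\<close>

lemma fps_to_fls_tendsto:
  fixes f :: "nat \<Rightarrow> 'a::field fps"
  assumes dvd: "\<And>k. fps_X ^ h k dvd f k - g"
    and h: "filterlim h at_top sequentially"
  shows "(\<lambda>k. fps_to_fls (f k)) \<longlonglongrightarrow> fps_to_fls g"
proof -
  have dist_le: "dist (fps_to_fls (f k)) (fps_to_fls g) \<le> (1/2) ^ h k" for k
  proof (cases "f k = g")
    case False
    have deg: "fls_subdegree (fps_to_fls (f k) - fps_to_fls g) = int (subdegree (f k - g))"
      by (simp only: fps_to_fls_minus[symmetric] fls_subdegree_fls_to_fps)
    have "h k \<le> subdegree (f k - g)"
      using dvd[of k] False by (simp add: fps_dvd_iff fps_X_power_subdegree)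
    then have "(1/2 :: real) ^ subdegree (f k - g) \<le> (1/2) ^ h k"
      by (intro power_decreasing) auto
    moreover have "dist (fps_to_fls (f k)) (fps_to_fls g) = (1/2) ^ subdegree (f k - g)"
      using False by (simp add: dist_fls_def deg power_one_over inverse_eq_divide)
    ultimately show ?thesis by simp
  qed simp
  have "(\<lambda>k. (1/2 :: real) ^ h k) \<longlonglongrightarrow> 0"
    by (rule filterlim_compose[OF _ h]) (intro LIMSEQ_realpow_zero, auto)
  then have "(\<lambda>k. dist (fps_to_fls (f k)) (fps_to_fls g)) \<longlonglongrightarrow> 0"
    by (rule tendsto_sandwich[rotated 3, OF _ _ _ tendsto_const])
      (simp_all add: dist_le)
  then show ?thesis
    by (rule iffD2[OF tendsto_dist_iff])
qed

text \<open>Since 1/a - 1/b = (b - a)/(ab), inversion of units respects congruences modulo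
  \<open>d\<close>.\<close>

lemma fps_dvd_inverse_diff:
  fixes a b :: "'a::field fps"
  assumes "a $ 0 \<noteq> 0" "b $ 0 \<noteq> 0" "d dvd a - b"
  shows "d dvd inverse a - inverse b"
proof -
  have "inverse a - inverse b = (inverse b * b) * inverse a - (inverse a * a) * inverse b"
    using assms(1,2) by (simp add: inverse_mult_eq_1)
  also have "\<dots> = (a - b) * (- (inverse a * inverse b))"
    by (simp add: algebra_simps)
  finally show ?thesis using assms(3) by (simp only: dvd_mult2)
qed

lemma fps_to_fls_inverse:
  fixes f :: "'a::field fps"
  assumes "f $ 0 \<noteq> 0"
  shows "fps_to_fls (inverse f) = inverse (fps_to_fls f)"
  using assms by (simp add: fls_inverse_fps_to_fls subdegree_eq_0)

lemmas fps_to_fls_hom = fls_times_fps_to_fls fps_to_fls_power fps_to_fls_inverse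

section \<open>The regular continued fraction of the metallic numbers\<close>

lemma metallic_bounds:
  assumes "n > 0"
  shows "real n < metallic n" "metallic n < real n + 1"
proof -
  have "real n < sqrt ((real n)\<^sup>2 + 4)"
    by (rule real_less_rsqrt) simp
  then show "real n < metallic n" by (simp add: metallic_def)
  have "sqrt ((real n)\<^sup>2 + 4) < real n + 2"
    using assms by (intro real_less_lsqrt) (auto simp: power2_eq_square algebra_simps)
  then show "metallic n < real n + 1" by (simp add: metallic_def)
qed

text \<open>\<open>metallic n\<close> is a root of y^2 - n y - 1 = 0, that is, y (y - n) =
  1.\<close>

lemma metallic_eq:
  assumes "n > 0"
  shows "1 / (metallic n - real n) = metallic n"
proof -
  have "(sqrt ((real n)\<^sup>2 + 4))\<^sup>2 = (real n)\<^sup>2 + 4"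
    by simp
  then have "metallic n * (metallic n - real n) = 1"
    by (simp add: metallic_def field_simps power2_eq_square)
  then show ?thesis
    using metallic_bounds[OF assms] by (simp add: field_simps)
qed

lemma floor_metallic: "n > 0 \<Longrightarrow> \<lfloor>metallic n\<rfloor> = int n"
  using metallic_bounds[of n] by (intro floor_unique) auto

lemma cf_complete_quot_metallic:
  assumes "n > 0"
  shows "cf_complete_quot (metallic n) i = metallic n"
  using assms by (induction i) (simp_all add: frac_def floor_metallic metallic_eq)

lemma cf_quot_metallic: "n > 0 \<Longrightarrow> cf_quot (metallic n) i = int n"
  by (simp add: cf_quot_def cf_complete_quot_metallic floor_metallic)

section \<open>Quantum integers as power series\<close>

text \<open>Power series counterpart of \<open>q_int\<close>: divisibility by powers of q measures
  closeness in \<open>fps\<close> but says nothing in the field \<open>fls\<close>.\<close>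

definition fps_q_int :: "nat \<Rightarrow> 'a::field fps" where
  "fps_q_int n = (\<Sum>i<n. fps_X ^ i)"

definition fps_q_angle :: "nat \<Rightarrow> 'a::field fps" where
  "fps_q_angle n = fps_X * fps_q_int n + (1 + fps_X ^ n) * (1 - fps_X)"

lemma one_minus_X_mult_fps_q_int: "(1 - fps_X) * fps_q_int n = 1 - fps_X ^ n"
  by (simp add: fps_q_int_def one_diff_power_eq)

lemma fps_q_int_nth_0: "n > 0 \<Longrightarrow> fps_q_int n $ 0 = 1"
  by (simp add: fps_q_int_def fps_sum_nth fps_power_zeroth power_0_left)

lemma fps_q_angle_nth_0: "n > 0 \<Longrightarrow> fps_q_angle n $ 0 = 1"
  by (simp add: fps_q_angle_def fps_power_zeroth)

text \<open>The factor 1 - q in the second summand of \<open>fps_q_angle n\<close> turns [n]_q into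
  1 - q^n, and (1 - q^n)(1 + q^n) = 1 - q^(2n).\<close>

lemma fps_q_int_mult_fps_q_angle:
  "fps_q_int n * fps_q_angle n = 1 + fps_X * (fps_q_int n)\<^sup>2 - fps_X ^ (2 * n)"
proof -
  have "fps_q_int n * fps_q_angle n
      = fps_X * (fps_q_int n)\<^sup>2 + ((1 - fps_X) * fps_q_int n) * (1 + fps_X ^ n :: 'a fps)"
    by (simp add: fps_q_angle_def power2_eq_square algebra_simps)
  also have "\<dots> = fps_X * (fps_q_int n)\<^sup>2 + (1 - fps_X ^ n) * (1 + fps_X ^ n)"
    by (simp only: one_minus_X_mult_fps_q_int)
  finally show ?thesis
    by (simp add: algebra_simps power2_eq_square flip: power_add mult_2)
qed

lemma q_int_eq: "q_int (int n) = fps_to_fls (fps_q_int n)"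
proof -
  have "(1 - fls_X) * fps_to_fls (fps_q_int n) = fps_to_fls ((1 - fps_X) * fps_q_int n :: 'a fps)"
    by (simp add: fps_to_fls_hom)
  also have "\<dots> = 1 - fls_X ^ n"
    by (simp add: one_minus_X_mult_fps_q_int fps_to_fls_hom)
  finally have *: "(1 - fls_X) * fps_to_fls (fps_q_int n :: 'a fps) = 1 - fls_X ^ n" .
  have "(1 - fps_X :: 'a fps) $ 0 \<noteq> 0" by simp
  then have "(1 - fps_X :: 'a fps) \<noteq> 0" by (metis fps_zero_nth)
  then have "(1 - fls_X :: 'a fls) \<noteq> 0"
    by (metis fps_X_to_fls fps_one_to_fls fps_to_fls_eq_0_iff fps_to_fls_minus)
  then show ?thesis
    using * by (simp add: q_int_def field_simps del: fls_X_power_int)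
qed

lemma q_angle_eq: "q_angle n = fps_to_fls (fps_q_angle n)"
  by (simp add: q_angle_def fps_q_angle_def q_int_eq fps_to_fls_hom)

section \<open>The fixed points\<close>

definition angle_step :: "nat \<Rightarrow> 'a::field fps \<Rightarrow> 'a fps" where
  "angle_step n z = fps_q_angle n + fps_X ^ (2 * n + 1) * inverse z"

definition metallic_step :: "nat \<Rightarrow> 'a::field fps \<Rightarrow> 'a fps" where
  "metallic_step n x =
     fps_q_int n + fps_X ^ (2 * n) * (x * inverse (1 + fps_X * fps_q_int n * x))"

lemma angle_step_nth_0: "n > 0 \<Longrightarrow> angle_step n z $ 0 = 1"
  by (simp add: angle_step_def fps_q_angle_nth_0)

lemma metallic_step_nth_0: "n > 0 \<Longrightarrow> metallic_step n x $ 0 = 1"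
  by (simp add: metallic_step_def fps_q_int_nth_0 fps_power_zeroth)

lemma angle_step_contraction:
  assumes "y $ 0 \<noteq> 0" "z $ 0 \<noteq> 0" "fps_X ^ k dvd y - z"
  shows "fps_X ^ Suc k dvd angle_step n y - angle_step n z"
proof -
  have "angle_step n y - angle_step n z
      = fps_X ^ (2 * n) * (fps_X * (inverse y - inverse z))"
    by (simp add: angle_step_def algebra_simps)
  moreover have "fps_X ^ Suc k dvd fps_X * (inverse y - inverse z)"
    using fps_dvd_inverse_diff[OF assms] by (simp add: mult_dvd_mono)
  ultimately show ?thesis by (simp only: dvd_mult)
qed

lemma metallic_step_contraction:
  assumes "n > 0" "fps_X ^ k dvd x - y"
  shows "fps_X ^ Suc k dvd metallic_step n x - metallic_step n y"
proof -
  define u where "u = (\<lambda>t :: 'a fps. 1 + fps_X * fps_q_int n * t)"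
  \<comment> \<open>The factor \<open>fps_X\<close> makes \<open>u t\<close> a unit for every
    \<open>t\<close>, whatever its constant term.\<close>
  have u0: "u t $ 0 \<noteq> 0" for t by (simp add: u_def mult.assoc)
  have "u x - u y = fps_X * fps_q_int n * (x - y)" by (simp add: u_def algebra_simps)
  then have "fps_X ^ k dvd u x - u y" using assms(2) by simp
  then have inv: "fps_X ^ k dvd inverse (u x) - inverse (u y)"
    using u0 by (intro fps_dvd_inverse_diff)
  have "x * inverse (u x) - y * inverse (u y)
      = (x - y) * inverse (u x) + y * (inverse (u x) - inverse (u y))"
    by (simp add: algebra_simps)
  then have "fps_X ^ k dvd x * inverse (u x) - y * inverse (u y)"
    using assms(2) inv by (simp only: dvd_add dvd_mult dvd_mult2)
  then have dvd: "fps_X ^ (2 * n) * fps_X ^ k dvd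
      fps_X ^ (2 * n) * (x * inverse (u x) - y * inverse (u y))"
    by (rule mult_dvd_mono[OF dvd_refl])
  have diff: "metallic_step n x - metallic_step n y
      = fps_X ^ (2 * n) * (x * inverse (u x) - y * inverse (u y))"
    by (simp add: metallic_step_def u_def algebra_simps)
  have "fps_X ^ Suc k dvd (fps_X ^ (2 * n) * fps_X ^ k :: 'a fps)"
    unfolding power_add[symmetric] using assms(1) by (intro le_imp_power_dvd) simp
  from dvd_trans[OF this dvd] show ?thesis by (simp only: diff)
qed

text \<open>Fixed point iteration, started at \<open>fps_q_angle n\<close> because its iterates are
  then exactly the truncations of the periodic continued fraction.\<close>

lemma angle_step_limit:
  assumes n: "n > 0"
  obtains z :: "'a::field fps"
  where "z $ 0 = 1" "angle_step n z = z"
    "\<And>k. fps_X ^ k dvd (angle_step n ^^ k) (fps_q_angle n) - z"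
proof -
  define f :: "nat \<Rightarrow> 'a fps" where "f k = (angle_step n ^^ k) (fps_q_angle n)" for k
  have f_Suc: "f (Suc k) = angle_step n (f k)" for k by (simp add: f_def)
  have f0: "f k $ 0 = 1" for k
    using n by (cases k) (simp_all add: f_def fps_q_angle_nth_0 angle_step_nth_0)
  have "fps_X ^ k dvd f (Suc k) - f k" for k
  proof (induction k)
    case (Suc k)
    then show ?case
      using angle_step_contraction[of "f (Suc k)" "f k" k n] by (simp only: f_Suc[symmetric] f0) simp
  qed simp
  then obtain z where z: "\<And>k. fps_X ^ k dvd f k - z"
    using fps_X_adic_limit_exists[of f] by blast
  \<comment> \<open>Modulo q the limit agrees with the first iterate; \<open>z\<close> has to be a
    unit before the contraction applies to it.\<close>
  have "f 1 $ 0 - z $ 0 = 0"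
    using z[of 1] unfolding fps_X_power_dvd_iff by simp
  then have z0: "z $ 0 = 1" by (simp add: f0)
  \<comment> \<open>Both \<open>z\<close> and \<open>angle_step n z\<close> are congruent to
    \<open>f (Suc k)\<close> modulo q^(k+1).\<close>
  have "fps_X ^ k dvd angle_step n z - z" for k
  proof -
    have "fps_X ^ Suc k dvd f (Suc k) - angle_step n z"
      unfolding f_Suc using z[of k] z0 f0[of k] by (intro angle_step_contraction) auto
    from dvd_diff[OF z[of "Suc k"] this] have "fps_X ^ Suc k dvd angle_step n z - z"
      by (simp only: diff_diff_eq2 diff_add_cancel) simp
    then show ?thesis by (rule power_le_dvd) simp
  qed
  then have "angle_step n z - z = 0" by (rule fps_eq_0_if_X_power_dvd)
  then show ?thesis using that[of z] z z0 by (simp add: f_def)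
qed

text \<open>The point is z x = 1 + q A x for x = A + Q/z: then x / (1 + q A x) = 1/z, and the step
  returns A + Q/z = x.\<close>

lemma metallic_step_fixed_point:
  fixes z :: "'a::field fps"
  assumes "z $ 0 = 1" and fixed: "angle_step n z = z"
  shows "metallic_step n (fps_q_int n + fps_X ^ (2 * n) * inverse z)
    = fps_q_int n + fps_X ^ (2 * n) * inverse z"
proof -
  define A B Q q :: "'a fps" where "A = fps_q_int n" and "B = fps_q_angle n"
    and "Q = fps_X ^ (2 * n)" and "q = fps_X"
  define w where "w = inverse z"
  define x where "x = A + Q * w"
  have zw: "z * w = 1" using assms(1) by (simp add: w_def inverse_mult_eq_1')
  have AB: "A * B = 1 + q * A\<^sup>2 - Q"
    unfolding A_def B_def Q_def q_def by (rule fps_q_int_mult_fps_q_angle)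
  have z: "z = B + q * Q * w"
    using fixed by (simp add: angle_step_def B_def Q_def q_def w_def)
  have "z * x = A * z + Q * (z * w)" by (simp add: x_def algebra_simps)
  also have "\<dots> = A * (B + q * Q * w) + Q" by (simp add: zw flip: z)
  also have "\<dots> = A * B + q * A * Q * w + Q" by (simp add: algebra_simps)
  \<comment> \<open>The last Q cancels the -Q in \<open>AB\<close>, and A + Q w is x again.\<close>
  also have "\<dots> = 1 + q * A * x" by (simp add: AB x_def power2_eq_square algebra_simps)
  finally have zx: "z * x = 1 + q * A * x" .
  define u where "u = 1 + q * A * x"
  have "u $ 0 \<noteq> 0" by (simp add: u_def q_def mult.assoc)
  then have u: "u * inverse u = 1" by (rule inverse_mult_eq_1')
  have "x * inverse u = (w * z) * (x * inverse u)" using zw by (simp add: mult.commute)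
  also have "\<dots> = w * (z * x * inverse u)" by (simp add: algebra_simps)
  also have "\<dots> = w" using u by (simp add: zx u_def)
  finally show ?thesis
    by (simp add: metallic_step_def u_def x_def A_def Q_def q_def w_def)
qed

section \<open>Truncations\<close>

lemma cfrac_trunc_const_Suc:
  "cfrac_trunc (\<lambda>_. c) (\<lambda>_. b) (Suc N) = b + c / cfrac_trunc (\<lambda>_. c) (\<lambda>_. b) N"
  by simp

lemma fps_to_fls_angle_step:
  assumes "z $ 0 \<noteq> 0"
  shows "fps_to_fls (angle_step n z) = q_angle n + fls_X ^ (2 * n + 1) / fps_to_fls z"
  using assms by (simp add: angle_step_def q_angle_eq fps_to_fls_hom divide_inverse)

lemma cfrac_trunc_angle:
  assumes "n > 0"
  shows "cfrac_trunc (\<lambda>_. fls_X ^ (2 * n + 1)) (\<lambda>_. q_angle n) N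
    = fps_to_fls ((angle_step n ^^ N) (fps_q_angle n))"
proof (induction N)
  case (Suc N)
  \<comment> \<open>With a nonzero constant term, division in \<open>fls\<close> is the image of
    \<open>inverse\<close> in \<open>fps\<close>.\<close>
  have "(angle_step n ^^ N) (fps_q_angle n :: 'a fps) $ 0 = 1"
    using assms by (cases N) (simp_all add: fps_q_angle_nth_0 angle_step_nth_0)
  then show ?case
    by (simp only: cfrac_trunc_const_Suc Suc) (simp add: fps_to_fls_angle_step)
qed (simp add: q_angle_eq)

lemma cfrac_trunc_metallic_Suc:
  "cfrac_trunc (metallic_num n) (metallic_den n) (Suc N)
    = q_int (int n) + fls_X ^ (2 * n) / cfrac_trunc (\<lambda>_. fls_X ^ (2 * n + 1)) (\<lambda>_. q_angle n) N"
  by (simp add: metallic_num_def metallic_den_def)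

lemma cfrac_trunc_sigma_Suc:
  "cfrac_trunc (sigma_num n) (sigma_den n) (Suc N)
    = fls_X ^ (n - 1) / cfrac_trunc (\<lambda>_. fls_X ^ (2 * n + 1)) (\<lambda>_. q_angle n) N"
  by (simp add: sigma_num_def sigma_den_def)

lemma q_real_trunc_step:
  fixes t :: "'a::field fps"
  assumes n: "n > 0" and t: "t $ 0 = 1"
    and trunc: "cfrac_trunc (q_real_num (metallic n)) (q_real_den (metallic n)) N = fps_to_fls t"
  shows "cfrac_trunc (q_real_num (metallic n)) (q_real_den (metallic n)) (Suc (Suc N))
    = fps_to_fls (metallic_step n t)"
proof -
  define A q where "A = fps_to_fls (fps_q_int n :: 'a fps)" and "q = (fls_X :: 'a fls)"
  define x where "x = fps_to_fls t"
  have q: "q \<noteq> 0" by (simp add: q_def)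
  have "t \<noteq> 0" using t by auto
  then have x: "x \<noteq> 0" by (simp add: x_def)
  have u0: "(1 + fps_X * fps_q_int n * t) $ 0 \<noteq> 0" by (simp add: mult.assoc)
  then have "1 + fps_X * fps_q_int n * t \<noteq> 0" by (metis fps_zero_nth)
  then have "fps_to_fls (1 + fps_X * fps_q_int n * t) \<noteq> 0" by (simp only: fps_to_fls_eq_0_iff) simp
  then have u: "1 + q * A * x \<noteq> 0" by (simp add: fps_to_fls_hom A_def q_def x_def)
  \<comment> \<open>All partial quotients equal n, so the coefficients depend only on the parity of
    the index, and removing two levels leaves the same fraction truncated at
    \<open>N\<close>.\<close>
  have periodic: "q_real_num (metallic n) (Suc (Suc i)) = (q_real_num (metallic n) i :: 'a fls)"
    "q_real_den (metallic n) (Suc (Suc i)) = (q_real_den (metallic n) i :: 'a fls)" for i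
    using n by (simp_all add: q_real_num_def q_real_den_def cf_quot_metallic)
  have "cfrac_trunc (q_real_num (metallic n)) (q_real_den (metallic n)) (Suc (Suc N))
      = A + q ^ n / (q powi (1 - int n) * A + q powi (- int n) / x)"
    using n by (simp add: periodic trunc del: fls_X_power_int)
      (simp add: q_real_num_def q_real_den_def cf_quot_metallic q_int_inv_def q_int_eq
        A_def q_def x_def del: fls_X_power_int)
  \<comment> \<open>Multiplying by q^n x turns q^(1-n) A into q A x and q^(-n)/x into 1, which
    removes the negative powers.\<close>
  also have "q powi (1 - int n) * A + q powi (- int n) / x = (1 + q * A * x) / (q ^ n * x)"
    using q x by (simp add: power_int_diff power_int_minus field_simps)
  also have "A + q ^ n / ((1 + q * A * x) / (q ^ n * x)) = A + q ^ (2 * n) * (x / (1 + q * A * x))"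
    by (simp add: mult_2 power_add)
  also have "\<dots> = fps_to_fls (metallic_step n t)"
    using u0 by (simp add: metallic_step_def fps_to_fls_hom divide_inverse A_def q_def x_def)
  finally show ?thesis .
qed

text \<open>
  For odd \<open>N\<close> the iteration starts at the truncation \<open>A + q\<^sup>n / (q\<^bsup>1-n\<^esup> A) = A + q\<^bsup>2n-1\<^esup> / A\<close>.
\<close>
lemma q_real_trunc_eq:
  assumes n: "n > 0"
  shows "\<exists>t :: 'a::field fps. t $ 0 = 1 \<and>
    cfrac_trunc (q_real_num (metallic n)) (q_real_den (metallic n)) N
      = fps_to_fls ((metallic_step n ^^ (N div 2)) t)"
proof (induction N rule: induct_nat_012)
  case 0
  have "cfrac_trunc (q_real_num (metallic n)) (q_real_den (metallic n)) 0
      = fps_to_fls (fps_q_int n :: 'a fps)"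
    using n by (simp add: q_real_den_def cf_quot_metallic q_int_eq)
  then show ?case using fps_q_int_nth_0[OF n, where 'a = 'a] by auto
next
  case 1
  define t :: "'a fps" where "t = fps_q_int n + fps_X ^ (2 * n - 1) * inverse (fps_q_int n)"
  have A0: "fps_q_int n $ 0 = (1 :: 'a)" using n by (rule fps_q_int_nth_0)
  have "cfrac_trunc (q_real_num (metallic n)) (q_real_den (metallic n)) (Suc 0) =
      fps_to_fls (fps_q_int n) + fls_X ^ n / (fls_X powi (1 - int n) * fps_to_fls (fps_q_int n))"
    using n by (simp add: q_real_num_def q_real_den_def cf_quot_metallic q_int_inv_def q_int_eq
        del: fls_X_power_int)
  also have "fls_X powi (1 - int n) = (inverse (fls_X ^ (n - 1)) :: 'a fls)"
    using n by (cases n) (simp_all add: power_int_minus del: fls_X_power_int)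
  also have "fps_to_fls (fps_q_int n) + fls_X ^ n / (inverse (fls_X ^ (n - 1)) * fps_to_fls (fps_q_int n))
      = fps_to_fls t"
  proof -
    have "2 * n - 1 = n + (n - 1)" using n by simp
    then show ?thesis
      using A0 by (simp add: t_def fps_to_fls_hom divide_inverse power_add)
  qed
  finally have "cfrac_trunc (q_real_num (metallic n)) (q_real_den (metallic n)) (Suc 0)
    = fps_to_fls t" .
  moreover have "t $ 0 = 1" using n A0 by (simp add: t_def fps_power_zeroth)
  ultimately show ?case by auto
next
  case (ge2 N)
  then obtain t :: "'a fps" where t: "t $ 0 = 1"
    "cfrac_trunc (q_real_num (metallic n)) (q_real_den (metallic n)) N
      = fps_to_fls ((metallic_step n ^^ (N div 2)) t)" by blast
  \<comment> \<open>Zero iterations leave \<open>t\<close>; after at least one, the constant term is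
    1 by \<open>metallic_step_nth_0\<close>.\<close>
  have "(metallic_step n ^^ (N div 2)) t $ 0 = 1"
    using n t(1) by (cases "N div 2") (simp_all add: metallic_step_nth_0)
  from q_real_trunc_step[OF n this t(2)] t(1) show ?case by auto
qed

lemma q_real_metallic_eq:
  fixes x :: "'a::field fps"
  assumes n: "n > 0" and fixed: "metallic_step n x = x"
  shows "q_real (metallic n) = fps_to_fls x"
proof -
  \<comment> \<open>The estimate is uniform in the start \<open>t\<close>, which may vary with the
    truncation below.\<close>
  have iterate: "fps_X ^ k dvd (metallic_step n ^^ k) t - x" for k t
  proof (induction k)
    case (Suc k)
    then show ?case
      using metallic_step_contraction[OF n, of k "(metallic_step n ^^ k) t" x] fixed by simp
  qed simp
  obtain t :: "nat \<Rightarrow> 'a fps" where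
    t: "\<And>N. cfrac_trunc (q_real_num (metallic n)) (q_real_den (metallic n)) N
      = fps_to_fls ((metallic_step n ^^ (N div 2)) (t N))"
    using q_real_trunc_eq[OF n, where 'a = 'a] by metis
  have "filterlim (\<lambda>N::nat. N div 2) at_top sequentially"
    unfolding filterlim_at_top eventually_sequentially
    by (metis div_le_mono div_mult_self1_is_m zero_less_numeral)
  then have "(\<lambda>N. fps_to_fls ((metallic_step n ^^ (N div 2)) (t N))) \<longlonglongrightarrow> fps_to_fls x"
    by (rule fps_to_fls_tendsto[OF iterate])
  then have "cfrac_trunc (q_real_num (metallic n)) (q_real_den (metallic n)) \<longlonglongrightarrow> fps_to_fls x"
    by (simp add: t[symmetric])
  then show ?thesis unfolding q_real_def by (rule limI)
qed

section \<open>The super fraction\<close>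

lemma super_fraction_sigma:
  assumes n: "n > 0"
  shows "super_fraction 3 (sigma_num n :: nat \<Rightarrow> 'a::field fls) (sigma_den n)"
proof -
  \<comment> \<open>This is (B - 1)/q, obtained by expanding (1 + q^n)(1 - q) in B =
    \<open>fps_q_angle n\<close>.\<close>
  define U :: "'a poly"
    where "U = (\<Sum>i<n. monom 1 i) - 1 + monom 1 (n - 1) - monom 1 n"
  have "degree (\<Sum>i<n. monom 1 i :: 'a poly) \<le> n"
    by (intro degree_sum_le) (auto intro: order_trans[OF degree_monom_le])
  then have "degree U \<le> n"
    unfolding U_def
    by (intro degree_diff_le degree_add_le) (auto intro: order_trans[OF degree_monom_le])
  have "fps_of_poly U = fps_q_int n - 1 + fps_X ^ (n - 1) - fps_X ^ n"
    by (simp add: U_def fps_q_int_def fps_of_poly_add fps_of_poly_diff fps_of_poly_sum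
        fps_of_poly_monom')
  then have "fps_q_int n = fps_of_poly U + 1 - fps_X ^ (n - 1) + fps_X ^ n"
    by (simp add: algebra_simps)
  then have "fps_q_angle n = 1 + fps_X * fps_of_poly U - fps_X * fps_X ^ (n - 1) + fps_X ^ n"
    by (simp only: fps_q_angle_def) (simp add: algebra_simps)
  moreover have "fps_X * fps_X ^ (n - 1) = (fps_X ^ n :: 'a fps)"
    using n by (cases n) simp_all
  ultimately have "fps_q_angle n = 1 + fps_X * fps_of_poly U"
    by simp
  then have angle: "q_angle n = 1 + fls_X * fps_to_fls (fps_of_poly U)"
    by (simp add: q_angle_eq fps_to_fls_hom)
  \<comment> \<open>The leading q^(n-1) forces k_0 = n - 1, and the exponent 2n + 1 then makes every
    k_i equal to n - 1; the degree bound becomes n.\<close>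
  have exponent: "n - 1 + (n - 1) + 3 = 2 * n + 1" using n by simp
  show ?thesis
    unfolding super_fraction_def
  proof (intro conjI exI)
    \<comment> \<open>The constants -1 for positive i cancel the minus signs built into a super
      fraction.\<close>
    show "\<forall>i. (if i = 0 then 1 else - 1 :: 'a) \<noteq> 0" by simp
    show "\<forall>i\<ge>1. U = 0 \<or> int (degree U) \<le> int (n - 1) + int 3 - 2"
      using \<open>degree U \<le> n\<close> n by auto
    show "sigma_num n 0 = fls_const (if (0::nat) = 0 then 1 else - 1 :: 'a) * fls_X ^ (n - 1)"
      by (simp add: sigma_num_def)
    show "\<forall>i\<ge>1. sigma_num n i
        = - (fls_const (if i = 0 then 1 else - 1 :: 'a) * fls_X ^ (n - 1 + (n - 1) + 3))"
      unfolding exponent by (auto simp: sigma_num_def)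
    show "\<forall>i\<ge>1. sigma_den n i = 1 + fls_X * fps_to_fls (fps_of_poly U)"
      by (auto simp: sigma_den_def angle)
  qed (simp_all add: sigma_den_def)
qed

section \<open>Convergence of both continued fractions from the common fixed point\<close>

theorem theorem3p2:
  fixes n :: nat
  assumes "n > 0"
  shows "(\<forall>i. cf_quot (metallic n) i = int n) \<and>
    (cfrac_trunc (metallic_num n) (metallic_den n)
       \<longlonglongrightarrow> (q_real (metallic n) :: 'a::field fls)) \<and>
    (cfrac_trunc (sigma_num n) (sigma_den n)
       \<longlonglongrightarrow> (sigma_q_metallic n :: 'a fls)) \<and>
    super_fraction 3 (sigma_num n :: nat \<Rightarrow> 'a fls) (sigma_den n)"
proof -
  obtain z :: "'a fps" where z: "z $ 0 = 1" "angle_step n z = z"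
    "\<And>k. fps_X ^ k dvd (angle_step n ^^ k) (fps_q_angle n) - z"
    using angle_step_limit[OF assms] by blast
  define f where "f k = (angle_step n ^^ k) (fps_q_angle n :: 'a fps)" for k
  have f0: "f k $ 0 = 1" for k
    using assms by (cases k) (simp_all add: f_def fps_q_angle_nth_0 angle_step_nth_0)
  have inv: "fps_X ^ k dvd inverse (f k) - inverse z" for k
    using z(3)[of k] z(1) f0[of k] by (intro fps_dvd_inverse_diff) (simp_all add: f_def)
  \<comment> \<open>Any fixed point of \<open>metallic_step n\<close> is [y_n]_q, in particular the
    one built from \<open>z\<close>.\<close>
  have q_real: "q_real (metallic n) = fps_to_fls (fps_q_int n + fps_X ^ (2 * n) * inverse z)"
    by (rule q_real_metallic_eq[OF assms metallic_step_fixed_point[OF z(1,2)]])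
  have "fps_X ^ k dvd (fps_q_int n + fps_X ^ (2 * n) * inverse (f k))
      - (fps_q_int n + fps_X ^ (2 * n) * inverse z)" for k
    using dvd_mult[OF inv[of k], of "fps_X ^ (2 * n)"] by (simp add: algebra_simps)
  then have "(\<lambda>k. fps_to_fls (fps_q_int n + fps_X ^ (2 * n) * inverse (f k)))
      \<longlonglongrightarrow> (q_real (metallic n) :: 'a fls)"
    unfolding q_real by (rule fps_to_fls_tendsto) (rule filterlim_ident)
  moreover have "cfrac_trunc (metallic_num n) (metallic_den n) (Suc k)
      = fps_to_fls (fps_q_int n + fps_X ^ (2 * n) * inverse (f k))" for k
    using f0[of k] unfolding cfrac_trunc_metallic_Suc cfrac_trunc_angle[OF assms] f_def[symmetric]
    by (simp add: q_int_eq fps_to_fls_hom divide_inverse)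
  \<comment> \<open>The first level can be split off only from index 1 on, so the limit is taken
    along the shifted sequence.\<close>
  ultimately have metallic:
    "cfrac_trunc (metallic_num n) (metallic_den n) \<longlonglongrightarrow> (q_real (metallic n) :: 'a fls)"
    by (subst filterlim_sequentially_Suc[symmetric]) (simp only:)
  \<comment> \<open>As n is positive, 2n = (n + 1) + (n - 1); dividing by q^(n+1) leaves the leading
    numerator q^(n-1).\<close>
  have "fls_X ^ (2 * n) = (fls_X ^ (n + 1) * fls_X ^ (n - 1) :: 'a fls)"
    unfolding power_add[symmetric] using assms by (simp add: mult_2)
  then have "q_real (metallic n) - q_int (int n)
      = fls_X ^ (n + 1) * fps_to_fls (fps_X ^ (n - 1) * inverse z)"
    using z(1) by (simp add: q_real q_int_eq fps_to_fls_hom)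
  then have sigma_q: "sigma_q_metallic n = fps_to_fls (fps_X ^ (n - 1) * inverse z)"
    unfolding sigma_q_metallic_def
    by (simp only: nonzero_mult_div_cancel_left[OF fls_X_pow_nonzero])
  have "fps_X ^ k dvd fps_X ^ (n - 1) * inverse (f k) - fps_X ^ (n - 1) * inverse z" for k
    using dvd_mult[OF inv[of k], of "fps_X ^ (n - 1)"] by (simp add: algebra_simps)
  then have "(\<lambda>k. fps_to_fls (fps_X ^ (n - 1) * inverse (f k)))
      \<longlonglongrightarrow> (sigma_q_metallic n :: 'a fls)"
    unfolding sigma_q by (rule fps_to_fls_tendsto) (rule filterlim_ident)
  moreover have "cfrac_trunc (sigma_num n) (sigma_den n) (Suc k)
      = fps_to_fls (fps_X ^ (n - 1) * inverse (f k))" for k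
    using f0[of k] unfolding cfrac_trunc_sigma_Suc cfrac_trunc_angle[OF assms] f_def[symmetric]
    by (simp add: fps_to_fls_hom divide_inverse)
  ultimately have sigma:
    "cfrac_trunc (sigma_num n) (sigma_den n) \<longlonglongrightarrow> (sigma_q_metallic n :: 'a fls)"
    by (subst filterlim_sequentially_Suc[symmetric]) (simp only:)
  show ?thesis
    using cf_quot_metallic[OF assms] metallic sigma super_fraction_sigma[OF assms] by blast
qed

end
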